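(* Let $d\ge 1$ be an integer, let $C$ be a finite set with $|C|=k>1$, and let $\varphi:\mathbb{R}^d\to C$ be a coloring of $\mathbb{R}^d$. Then $\varphi$ is an ordered Szlam coloring of $\mathbb{R}^d$ (in the sense defined in the context, i.e. up to identifying the colors $c_1,\dots,c_k$ of some ordering of $C$ with the indices $1,\dots,k$) if and only if there is an ordering $c_1,\dots,c_k$ of $C$ with respect to which $\varphi$ is dominant. Further, for every ordering $c_1,\dots,c_k$ of $C$ with respect to which $\varphi$ is dominant, there exist a partition $R,B$ of $\mathbb{R}^d$ and a set $F\subseteq\mathbb{R}^d$ with an ordering $f_1,\dots,f_k$ of $F$, such that no translate of $F$ is contained in $R$, and such that for every $j\in\{1,\dots,k\}$ and every $v\in\mathbb{R}^d$: $$\varphi(v)=c_j \iff \big(v+f_j\in B \text{ and } v+f_i\in R \text{ for all } i<j\big).$$ That is, $\varphi$ is the ordered Szlam coloring associated with $R,B,F$ and the ordering $f_1,\dots,f_k$ of $F$, with color $c_j$ corresponding to index $j$.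
   Context: Ordered Szlam coloring: Let $R,B$ be a partition of $\mathbb{R}^d$ (so $R=\mathbb{R}^d\setminus B$) and let $F\subseteq\mathbb{R}^d$ be a finite nonempty set such that no translate $v+F$ ($v\in\mathbb{R}^d$) is contained in $R$. Given an ordering $f_1,\dots,f_k$ of $F$, the ordered Szlam coloring of $\mathbb{R}^d$ associated with $R,B,F$ and this ordering is the function $\psi:\mathbb{R}^d\to\{1,\dots,k\}$ such that for each $v\in\mathbb{R}^d$, $\psi(v)$ is the smallest index $i$ with $v+f_i\in B$. A coloring $\varphi:\mathbb{R}^d\to C$ with $|C|=k$ is called an ordered Szlam coloring if, for some such $R,B,F$, ordering $f_1,\dots,f_k$ of $F$, and some ordering $c_1,\dots,c_k$ of $C$, one has $\varphi(v)=c_i\iff\psi(v)=i$ for all $v$. Dominance: For an ordering $c_1,\dots,c_k$ of $C$, let $A_i=\varphi^{-1}(\{c_i\})$ for $i=1,\dots,k$. The coloring $\varphi$ is dominant with respect to the ordering $c_1,\dots,c_k$ if there exist distinct vectors $t_2,\dots,t_k\in\mathbb{R}^d$ such that (i) $A_i+t_i\subseteq A_1$ for all $i\in\{2,\dots,k\}$, and (ii) $(A_j+t_i)\cap A_1=\emptyset$ for all $1<i<j\le k$. Here $A+t=\{a+t: a\in A\}$.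
   Formalization: In the "Further" part, f_1,…,f_k always lists F, but the f_i are asserted to be distinct only when every color of C is used; with an unused color distinctness can fail (k=3, φ(0)=c_3, φ(v)=c_1 otherwise, which forces f_1=f_2). *)

theory Defs
  imports "HOL-Analysis.Analysis"
begin

text \<open>
  Either part of the partition may be empty (it is just a set and its complement).
\<close>

definition szlam_triple ::
  "(real ^ 'n) set \<Rightarrow> (real ^ 'n) set \<Rightarrow> (real ^ 'n) set \<Rightarrow> bool" where
  "szlam_triple R B F \<longleftrightarrow>
     R \<union> B = UNIV \<and> R \<inter> B = {} \<and> finite F \<and> F \<noteq> {} \<and>
     (\<forall>v. \<not> (\<lambda>x. v + x) ` F \<subseteq> R)"

text \<open>
  Orderings \<open>f\<^sub>1, \<dots>, f\<^sub>k\<close> are functions on \<^typ>\<open>nat\<close>, of which only the values on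
  \<open>{1..k}\<close> matter.
\<close>

definition szlam_index ::
  "(real ^ 'n) set \<Rightarrow> (nat \<Rightarrow> real ^ 'n) \<Rightarrow> nat \<Rightarrow> real ^ 'n \<Rightarrow> nat" where
  "szlam_index B f k v = (LEAST i. i \<in> {1..k} \<and> v + f i \<in> B)"

definition ordered_szlam_coloring :: "'c set \<Rightarrow> (real ^ 'n \<Rightarrow> 'c) \<Rightarrow> bool" where
  "ordered_szlam_coloring C \<phi> \<longleftrightarrow>
     (\<exists>R B F f c. szlam_triple R B F \<and>
        bij_betw f {1..card C} F \<and> bij_betw c {1..card C} C \<and>
        (\<forall>v. \<forall>i\<in>{1..card C}. \<phi> v = c i \<longleftrightarrow> szlam_index B f (card C) v = i))"

text \<open>
  \<open>t\<^sub>i = 0\<close> is allowed; since \<open>A\<^sub>i\<close> and \<open>A\<^sub>1\<close> are disjoint, it forces \<open>A\<^sub>i = {}\<close>,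
  i.e. the color \<open>c\<^sub>i\<close> is not used.
\<close>

definition dominant :: "(real ^ 'n \<Rightarrow> 'c) \<Rightarrow> (nat \<Rightarrow> 'c) \<Rightarrow> nat \<Rightarrow> bool" where
  "dominant \<phi> c k \<longleftrightarrow>
     (let A = (\<lambda>i. \<phi> -` {c i}) in
      \<exists>t :: nat \<Rightarrow> real ^ 'n. inj_on t {2..k} \<and>
        (\<forall>i\<in>{2..k}. (\<lambda>a. a + t i) ` A i \<subseteq> A 1) \<and>
        (\<forall>i j. 1 < i \<and> i < j \<and> j \<le> k \<longrightarrow> (\<lambda>a. a + t i) ` A j \<inter> A 1 = {}))"

end

theory Submission imports Defs begin

text \<open>
  If \<open>\<phi>\<close> is the ordered Szlam coloring of \<open>R, B\<close> and \<open>f\<^sub>1, \<dots>, f\<^sub>k\<close>, then \<open>A\<^sub>1 = B - f\<^sub>1\<close>, and the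
  vectors \<open>t\<^sub>i = f\<^sub>i - f\<^sub>1\<close> witness dominance. Conversely, vectors \<open>t\<^sub>i\<close> witnessing dominance give
  the Szlam data \<open>B = A\<^sub>1\<close>, \<open>f\<^sub>1 = 0\<close>, \<open>f\<^sub>i = t\<^sub>i\<close>. These \<open>f\<^sub>i\<close> are distinct unless some \<open>t\<^sub>m = 0\<close>, in
  which case the color \<open>c\<^sub>m\<close> is unused. Moving an unused color to the last position preserves
  dominance and leaves its vector unconstrained, so that it can be chosen away from \<open>0\<close> and from
  the other vectors.
\<close>

definition first_hit :: "'a::plus set \<Rightarrow> (nat \<Rightarrow> 'a) \<Rightarrow> 'a \<Rightarrow> nat \<Rightarrow> bool" where
  "first_hit B f v j \<longleftrightarrow> v + f j \<in> B \<and> (\<forall>i\<in>{1..<j}. v + f i \<notin> B)"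

definition first_hit_coloring ::
  "'a::plus set \<Rightarrow> (nat \<Rightarrow> 'a) \<Rightarrow> (nat \<Rightarrow> 'c) \<Rightarrow> nat \<Rightarrow> ('a \<Rightarrow> 'c) \<Rightarrow> bool" where
  "first_hit_coloring B f c k \<phi> \<longleftrightarrow> (\<forall>j\<in>{1..k}. \<forall>v. \<phi> v = c j \<longleftrightarrow> first_hit B f v j)"

lemma first_hit_unique:
  assumes "first_hit B f v i" and "first_hit B f v j" and "1 \<le> i" and "1 \<le> j"
  shows "i = j"
  using assms by (cases i j rule: linorder_cases) (auto simp: first_hit_def)

lemma first_hit_coloringI:
  assumes "range \<phi> \<subseteq> c ` {1..k}"
    and hit: "\<And>j v. j \<in> {1..k} \<Longrightarrow> \<phi> v = c j \<Longrightarrow> first_hit B f v j"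
  shows "first_hit_coloring B f c k \<phi>"
  unfolding first_hit_coloring_def
proof (intro ballI allI iffI)
  fix j v assume j: "j \<in> {1..k}" "first_hit B f v j"
  obtain i where i: "i \<in> {1..k}" "\<phi> v = c i"
    using assms(1) by blast
  then have "i = j"
    using first_hit_unique[OF hit[OF i] j(2)] j(1) by simp
  then show "\<phi> v = c j"
    using i(2) by simp
qed (rule hit)

lemma first_hit_coloring_hits:
  assumes "first_hit_coloring B f c k \<phi>" and "range \<phi> \<subseteq> c ` {1..k}"
  shows "\<exists>i\<in>{1..k}. v + f i \<in> B"
  using assms unfolding first_hit_coloring_def first_hit_def by blast

lemma szlam_index_eq_iff_first_hit:
  assumes hits: "\<exists>i\<in>{1..k}. v + f i \<in> B" and j: "j \<in> {1..k}"
  shows "szlam_index B f k v = j \<longleftrightarrow> first_hit B f v j"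
proof
  let ?hit = "\<lambda>i. i \<in> {1..k} \<and> v + f i \<in> B"
  assume "szlam_index B f k v = j"
  then have least: "j = (LEAST i. ?hit i)"
    by (simp add: szlam_index_def)
  have "?hit j"
    unfolding least by (rule LeastI_ex) (use hits in blast)
  moreover have "\<not> ?hit i" if "i < j" for i
    using that not_less_Least[of i ?hit] unfolding least by blast
  ultimately show "first_hit B f v j"
    using j by (auto simp: first_hit_def)
next
  assume "first_hit B f v j"
  then show "szlam_index B f k v = j"
    unfolding szlam_index_def first_hit_def
    by (intro Least_equality) (use j in \<open>auto intro: leI\<close>)
qed

lemma szlam_triple_image_iff:
  fixes f :: "nat \<Rightarrow> real ^ 'n"
  shows "szlam_triple R B (f ` {1..k}) \<longleftrightarrow> R = - B \<and> (\<forall>v. \<exists>i\<in>{1..k}. v + f i \<in> B)"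
proof -
  have "R \<union> B = UNIV \<and> R \<inter> B = {} \<longleftrightarrow> R = - B"
    by blast
  moreover have "(\<forall>v. \<not> (\<lambda>x. v + x) ` f ` {1..k} \<subseteq> - B) \<longleftrightarrow>
      (\<forall>v. \<exists>i\<in>{1..k}. v + f i \<in> B)"
    by (simp add: image_subset_iff)
  ultimately show ?thesis
    unfolding szlam_triple_def by auto
qed

lemma ordered_szlam_coloring_iff_first_hit_coloring:
  assumes "range \<phi> \<subseteq> C"
  shows "ordered_szlam_coloring C \<phi> \<longleftrightarrow>
    (\<exists>B f c. inj_on f {1..card C} \<and> bij_betw c {1..card C} C \<and>
      first_hit_coloring B f c (card C) \<phi>)" (is "_ \<longleftrightarrow> ?first_hit")
proof
  assume "ordered_szlam_coloring C \<phi>"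
  then obtain R B F f c where triple: "szlam_triple R B F"
    and bij: "bij_betw f {1..card C} F" and ordering: "bij_betw c {1..card C} C"
    and index: "\<And>v i. i \<in> {1..card C} \<Longrightarrow> \<phi> v = c i \<longleftrightarrow> szlam_index B f (card C) v = i"
    unfolding ordered_szlam_coloring_def by blast
  have inj: "inj_on f {1..card C}" and image: "F = f ` {1..card C}"
    using bij by (auto simp: bij_betw_def)
  have "\<exists>i\<in>{1..card C}. v + f i \<in> B" for v
    using triple unfolding image szlam_triple_image_iff by blast
  then have "first_hit_coloring B f c (card C) \<phi>"
    unfolding first_hit_coloring_def using index szlam_index_eq_iff_first_hit by blast
  then show ?first_hit
    using inj ordering by blast
next
  assume ?first_hit
  then obtain B f c where inj: "inj_on f {1..card C}" and ordering: "bij_betw c {1..card C} C"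
    and coloring: "first_hit_coloring B f c (card C) \<phi>"
    by blast
  have hits: "\<exists>i\<in>{1..card C}. v + f i \<in> B" for v
    using first_hit_coloring_hits[OF coloring] assms bij_betw_imp_surj_on[OF ordering] by simp
  then have "szlam_triple (- B) B (f ` {1..card C})"
    unfolding szlam_triple_image_iff by blast
  moreover have "\<phi> v = c i \<longleftrightarrow> szlam_index B f (card C) v = i" if "i \<in> {1..card C}" for v i
    using coloring that szlam_index_eq_iff_first_hit[OF hits that]
    by (simp add: first_hit_coloring_def)
  ultimately show "ordered_szlam_coloring C \<phi>"
    unfolding ordered_szlam_coloring_def using inj_on_imp_bij_betw[OF inj] ordering by blast
qed

definition dominating_shifts ::
  "('a::plus \<Rightarrow> 'c) \<Rightarrow> (nat \<Rightarrow> 'c) \<Rightarrow> nat \<Rightarrow> (nat \<Rightarrow> 'a) \<Rightarrow> bool" where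
  "dominating_shifts \<phi> c k t \<longleftrightarrow>
     (\<forall>i\<in>{2..k}. \<forall>v. \<phi> v = c i \<longrightarrow> \<phi> (v + t i) = c 1) \<and>
     (\<forall>i\<in>{2..k}. \<forall>j\<in>{i<..k}. \<forall>v. \<phi> v = c j \<longrightarrow> \<phi> (v + t i) \<noteq> c 1)"

lemma dominating_shifts_into_first:
  assumes "dominating_shifts \<phi> c k t" and "i \<in> {2..k}" and "\<phi> v = c i"
  shows "\<phi> (v + t i) = c 1"
  using assms by (simp add: dominating_shifts_def)

lemma dominating_shifts_avoid_first:
  assumes "dominating_shifts \<phi> c k t" and "i \<in> {2..k}" and "j \<in> {i<..k}" and "\<phi> v = c j"
  shows "\<phi> (v + t i) \<noteq> c 1"
  using assms unfolding dominating_shifts_def by blast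

lemma dominant_iff_dominating_shifts:
  "dominant \<phi> c k \<longleftrightarrow> (\<exists>t. inj_on t {2..k} \<and> dominating_shifts \<phi> c k t)"
proof -
  have translate_subset: "(\<lambda>a. a + s) ` (\<phi> -` {x}) \<subseteq> \<phi> -` {y} \<longleftrightarrow>
      (\<forall>v. \<phi> v = x \<longrightarrow> \<phi> (v + s) = y)" for s x y
    by auto
  have translate_disjoint: "(\<lambda>a. a + s) ` (\<phi> -` {x}) \<inter> \<phi> -` {y} = {} \<longleftrightarrow>
      (\<forall>v. \<phi> v = x \<longrightarrow> \<phi> (v + s) \<noteq> y)" for s x y
    by auto
  have pairs: "(\<forall>i j. 1 < i \<and> i < j \<and> j \<le> k \<longrightarrow> P i j) \<longleftrightarrow> (\<forall>i\<in>{2..k}. \<forall>j\<in>{i<..k}. P i j)"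
    for P :: "nat \<Rightarrow> nat \<Rightarrow> bool"
    by force
  show ?thesis
    unfolding dominant_def dominating_shifts_def Let_def translate_subset translate_disjoint pairs
    by (rule refl)
qed

lemma dominating_shifts_if_first_hit_coloring:
  fixes \<phi> :: "'a::group_add \<Rightarrow> 'c"
  assumes "first_hit_coloring B f c k \<phi>"
  shows "dominating_shifts \<phi> c k (\<lambda>i. f i - f 1)"
proof -
  have color: "\<phi> v = c j \<longleftrightarrow> first_hit B f v j" if "j \<in> {1..k}" for j v
    using assms that by (simp add: first_hit_coloring_def)
  have "\<phi> (v + (f i - f 1)) = c 1 \<longleftrightarrow> v + f i \<in> B" if "i \<in> {2..k}" for i v
    using color[of 1] that by (simp add: first_hit_def add.assoc)
  then show ?thesis
    by (auto simp: dominating_shifts_def color first_hit_def)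
qed

lemma first_hit_coloring_if_dominating_shifts:
  fixes \<phi> :: "'a::monoid_add \<Rightarrow> 'c"
  assumes inj: "inj_on c {1..k}" and range: "range \<phi> \<subseteq> c ` {1..k}"
    and shifts: "dominating_shifts \<phi> c k t"
  shows "first_hit_coloring (\<phi> -` {c 1}) (t(1 := 0)) c k \<phi>"
proof (rule first_hit_coloringI[OF range])
  fix j v assume j: "j \<in> {1..k}" and color: "\<phi> v = c j"
  have "\<phi> (v + (t(1 := 0)) j) = c 1"
    using j color dominating_shifts_into_first[OF shifts, of j v] by auto
  moreover have "\<phi> (v + (t(1 := 0)) i) \<noteq> c 1" if "i \<in> {1..<j}" for i
  proof (cases "i = 1")
    case True
    then show ?thesis
      using that j color inj_onD[OF inj, of j 1] by auto
  next
    case False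
    then show ?thesis
      using that j color dominating_shifts_avoid_first[OF shifts, of i j v] by auto
  qed
  ultimately show "first_hit (\<phi> -` {c 1}) (t(1 := 0)) v j"
    by (simp add: first_hit_def)
qed

lemma zero_dominating_shift_unused:
  fixes \<phi> :: "'a::monoid_add \<Rightarrow> 'c"
  assumes inj: "inj_on c {1..k}" and shifts: "dominating_shifts \<phi> c k t"
    and m: "m \<in> {2..k}" and zero: "t m = 0"
  shows "c m \<notin> range \<phi>"
proof
  assume "c m \<in> range \<phi>"
  then obtain v where "\<phi> v = c m"
    by auto
  then have "c m = c 1"
    using dominating_shifts_into_first[OF shifts m, of v] zero by simp
  then show False
    using inj_onD[OF inj, of m 1] m by simp
qed

lemma inj_on_zero_at_one:
  fixes t :: "nat \<Rightarrow> 'a::zero"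
  assumes "inj_on t {2..k}" and "0 \<notin> t ` {2..k}"
  shows "inj_on (t(1 := 0)) {1..k}"
proof -
  have "inj_on (t(1 := 0)) (insert 1 {2..k})"
    using inj_on_fun_updI[OF assms] assms(2) by auto
  then show ?thesis
    by (rule inj_on_subset) auto
qed

definition move_to_last :: "nat \<Rightarrow> nat \<Rightarrow> nat \<Rightarrow> nat" where
  "move_to_last m k i = (if i < m then i else if i < k then Suc i else m)"

lemma move_to_last_last: "m \<le> k \<Longrightarrow> move_to_last m k k = m"
  by (simp add: move_to_last_def)

lemma strict_mono_on_move_to_last: "strict_mono_on {..<k} (move_to_last m k)"
  by (auto intro!: strict_mono_onI simp: move_to_last_def)

lemma bij_betw_move_to_last:
  assumes "m \<in> {a..k}"
  shows "bij_betw (move_to_last m k) {a..k} {a..k}"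
proof -
  have "inj_on (move_to_last m k) {a..k}"
    using assms by (auto simp: inj_on_def move_to_last_def)
  moreover have "move_to_last m k ` {a..k} \<subseteq> {a..k}"
    using assms by (auto simp: move_to_last_def)
  ultimately show ?thesis
    by (simp add: bij_betw_def endo_inj_surj)
qed

lemma dominating_shifts_reorder:
  assumes shifts: "dominating_shifts \<phi> c k t"
    and first: "p 1 = 1" and maps: "\<And>i. i \<in> {2..k} \<Longrightarrow> p i \<in> {2..k}"
    and mono: "strict_mono_on {..<k} p"
    and unused: "c (p k) \<notin> range \<phi>"
  shows "dominating_shifts \<phi> (c \<circ> p) k ((t \<circ> p)(k := s))"
  unfolding dominating_shifts_def
proof (intro conjI ballI allI impI)
  fix i v assume i: "i \<in> {2..k}" "\<phi> v = (c \<circ> p) i"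
  then have "i \<noteq> k"
    using unused by (metis comp_apply rangeI)
  moreover have "p i \<in> {2..k}"
    using maps[OF i(1)] .
  ultimately show "\<phi> (v + ((t \<circ> p)(k := s)) i) = (c \<circ> p) 1"
    using dominating_shifts_into_first[OF shifts] i(2) first by simp
next
  fix i j v assume ij: "i \<in> {2..k}" "j \<in> {i<..k}" "\<phi> v = (c \<circ> p) j"
  then have "j \<noteq> k"
    using unused by (metis comp_apply rangeI)
  then have "i < k" and "p i < p j"
    using ij strict_mono_onD[OF mono, of i j] by auto
  moreover have "p i \<in> {2..k}" and "p j \<in> {2..k}"
    using maps[of i] maps[of j] ij(1,2) by simp_all
  ultimately show "\<phi> (v + ((t \<circ> p)(k := s)) i) \<noteq> (c \<circ> p) 1"
    using dominating_shifts_avoid_first[OF shifts, of "p i" "p j" v] ij(3) first by simp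
qed

lemma dominating_shifts_move_to_last:
  assumes shifts: "dominating_shifts \<phi> c k t" and m: "m \<in> {2..k}" and unused: "c m \<notin> range \<phi>"
  shows "dominating_shifts \<phi> (c \<circ> move_to_last m k) k ((t \<circ> move_to_last m k)(k := s))"
proof (rule dominating_shifts_reorder[OF shifts])
  show "move_to_last m k 1 = 1"
    using m by (simp add: move_to_last_def)
  show "c (move_to_last m k k) \<notin> range \<phi>"
    using m unused by (simp add: move_to_last_last)
qed (use bij_betw_apply[OF bij_betw_move_to_last[OF m]] strict_mono_on_move_to_last in blast)+

lemma dominating_shifts_obtains_nonzero:
  fixes \<phi> :: "'a::monoid_add \<Rightarrow> 'c"
  assumes infinite: "infinite (UNIV :: 'a set)" and ordering: "bij_betw c {1..k} C"
    and inj: "inj_on t {2..k}" and shifts: "dominating_shifts \<phi> c k t"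
  obtains c' t' where "bij_betw c' {1..k} C" "inj_on t' {2..k}" "0 \<notin> t' ` {2..k}"
    "dominating_shifts \<phi> c' k t'"
proof (cases "0 \<in> t ` {2..k}")
  case False
  then show ?thesis
    using that ordering inj shifts by blast
next
  case True
  then obtain m where m: "m \<in> {2..k}" and zero: "t m = 0"
    by auto
  obtain s where fresh: "s \<notin> insert 0 (t ` {2..k})"
    using ex_new_if_finite[OF infinite, of "insert 0 (t ` {2..k})"] by blast
  define p where "p = move_to_last m k"
  have bij: "bij_betw p {1..k} {1..k}" "bij_betw p {2..k} {2..k}"
    unfolding p_def using m by (auto intro!: bij_betw_move_to_last)
  have inj_comp: "inj_on (t \<circ> p) {2..k}"
    using bij(2) inj by (simp add: bij_betw_def comp_inj_on)
  have image_comp: "(t \<circ> p) ` {2..k} = t ` {2..k}"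
    using bij(2) by (metis bij_betw_imp_surj_on image_comp)
  show ?thesis
  proof (rule that)
    show "bij_betw (c \<circ> p) {1..k} C"
      using bij_betw_trans[OF bij(1) ordering] .
    show "inj_on ((t \<circ> p)(k := s)) {2..k}"
      using inj_on_fun_updI[OF inj_comp] fresh unfolding image_comp by blast
    have "(t \<circ> p) k = 0"
      using m zero by (simp add: p_def move_to_last_last)
    then have "i = k" if "i \<in> {2..k}" "(t \<circ> p) i = 0" for i
      using inj_onD[OF inj_comp, of i k] that m by simp
    then show "0 \<notin> ((t \<circ> p)(k := s)) ` {2..k}"
      using fresh by (auto simp: fun_upd_def)
    show "dominating_shifts \<phi> (c \<circ> p) k ((t \<circ> p)(k := s))"
      unfolding p_def
      using zero_dominating_shift_unused[OF bij_betw_imp_inj_on[OF ordering] shifts m zero]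
      by (rule dominating_shifts_move_to_last[OF shifts m])
  qed
qed

lemma dominant_if_ordered_szlam_coloring:
  assumes "ordered_szlam_coloring C \<phi>" and "range \<phi> \<subseteq> C"
  obtains c where "bij_betw c {1..card C} C" "dominant \<phi> c (card C)"
proof -
  obtain B f c where inj: "inj_on f {1..card C}" and ordering: "bij_betw c {1..card C} C"
    and coloring: "first_hit_coloring B f c (card C) \<phi>"
    using assms(1) unfolding ordered_szlam_coloring_iff_first_hit_coloring[OF assms(2)] by blast
  have "inj_on (\<lambda>i. f i - f 1) {2..card C}"
    using inj_onD[OF inj] by (intro inj_onI) simp
  then have "dominant \<phi> c (card C)"
    unfolding dominant_iff_dominating_shifts
    using dominating_shifts_if_first_hit_coloring[OF coloring] by (intro exI conjI)
  then show ?thesis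
    using that ordering by blast
qed

lemma ordered_szlam_coloring_if_dominant:
  fixes \<phi> :: "real ^ 'n \<Rightarrow> 'c"
  assumes range: "range \<phi> \<subseteq> C" and ordering: "bij_betw c {1..card C} C"
    and dominant: "dominant \<phi> c (card C)"
  shows "ordered_szlam_coloring C \<phi>"
proof -
  obtain t where "inj_on t {2..card C}" "dominating_shifts \<phi> c (card C) t"
    using dominant unfolding dominant_iff_dominating_shifts by blast
  then obtain c' t' where ordering': "bij_betw c' {1..card C} C"
    and distinct: "inj_on t' {2..card C}" "0 \<notin> t' ` {2..card C}"
    and shifts: "dominating_shifts \<phi> c' (card C) t'"
    using dominating_shifts_obtains_nonzero[OF infinite_UNIV_char_0 ordering] by blast
  have "first_hit_coloring (\<phi> -` {c' 1}) (t'(1 := 0)) c' (card C) \<phi>"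
    using first_hit_coloring_if_dominating_shifts[OF _ _ shifts] ordering' range
    by (simp add: bij_betw_def)
  then show ?thesis
    unfolding ordered_szlam_coloring_iff_first_hit_coloring[OF range]
    using inj_on_zero_at_one[OF distinct] ordering' by blast
qed

lemma dominant_obtains_szlam_triple:
  fixes \<phi> :: "real ^ 'n \<Rightarrow> 'c"
  assumes range: "range \<phi> \<subseteq> C" and ordering: "bij_betw c {1..k} C" and dominant: "dominant \<phi> c k"
  obtains B f where "szlam_triple (- B) B (f ` {1..k})" "first_hit_coloring B f c k \<phi>"
    "range \<phi> = C \<Longrightarrow> bij_betw f {1..k} (f ` {1..k})"
proof -
  obtain t where distinct: "inj_on t {2..k}" and shifts: "dominating_shifts \<phi> c k t"
    using dominant unfolding dominant_iff_dominating_shifts by blast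
  have inj: "inj_on c {1..k}" and image: "c ` {1..k} = C"
    using ordering by (auto simp: bij_betw_def)
  have range_image: "range \<phi> \<subseteq> c ` {1..k}"
    using range image by simp
  note coloring = first_hit_coloring_if_dominating_shifts[OF inj range_image shifts]
  show ?thesis
  proof (rule that[OF _ coloring])
    show "szlam_triple (- (\<phi> -` {c 1})) (\<phi> -` {c 1}) (t(1 := 0) ` {1..k})"
      using first_hit_coloring_hits[OF coloring range_image]
      unfolding szlam_triple_image_iff by blast
  next
    assume "range \<phi> = C"
    then have "c i \<in> range \<phi>" if "i \<in> {2..k}" for i
      using image that by force
    then have "0 \<notin> t ` {2..k}"
      using zero_dominating_shift_unused[OF inj shifts] by (metis imageE)
    then show "bij_betw (t(1 := 0)) {1..k} (t(1 := 0) ` {1..k})"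
      by (intro inj_on_imp_bij_betw inj_on_zero_at_one distinct)
  qed
qed

theorem theorem3p1:
  fixes C :: "'c set" and k :: nat and \<phi> :: "real ^ 'n \<Rightarrow> 'c"
  assumes "finite C" and "card C = k" and "k > 1"
    and "range \<phi> \<subseteq> C"
  shows "(ordered_szlam_coloring C \<phi> \<longleftrightarrow> (\<exists>c. bij_betw c {1..k} C \<and> dominant \<phi> c k)) \<and>
    (\<forall>c. bij_betw c {1..k} C \<and> dominant \<phi> c k \<longrightarrow>
      (\<exists>R B F f. szlam_triple R B F \<and> f ` {1..k} = F \<and>
         (range \<phi> = C \<longrightarrow> bij_betw f {1..k} F) \<and>
         (\<forall>j\<in>{1..k}. \<forall>v. \<phi> v = c j \<longleftrightarrow>
            (v + f j \<in> B \<and> (\<forall>i\<in>{1..<j}. v + f i \<in> R)))))"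
proof (intro conjI allI impI)
  show "ordered_szlam_coloring C \<phi> \<longleftrightarrow> (\<exists>c. bij_betw c {1..k} C \<and> dominant \<phi> c k)"
    using dominant_if_ordered_szlam_coloring ordered_szlam_coloring_if_dominant assms(2,4) by metis
next
  fix c assume "bij_betw c {1..k} C \<and> dominant \<phi> c k"
  then obtain B f where "szlam_triple (- B) B (f ` {1..k})" "first_hit_coloring B f c k \<phi>"
    "range \<phi> = C \<Longrightarrow> bij_betw f {1..k} (f ` {1..k})"
    using dominant_obtains_szlam_triple[OF assms(4)] by metis
  then show "\<exists>R B F f. szlam_triple R B F \<and> f ` {1..k} = F \<and>
      (range \<phi> = C \<longrightarrow> bij_betw f {1..k} F) \<and>
      (\<forall>j\<in>{1..k}. \<forall>v. \<phi> v = c j \<longleftrightarrow>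
         (v + f j \<in> B \<and> (\<forall>i\<in>{1..<j}. v + f i \<in> R)))"
    unfolding first_hit_coloring_def first_hit_def by (metis Compl_iff)
qed

end
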